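(* If $h$ is a left-invariant metric on $\mathrm{SO}(4)$ of nonnegative sectional curvature with matrix $\Phi$, then $\mathfrak g=\mathfrak{so}(4)$ has a $2$-dimensional abelian subalgebra that is $\Phi$-invariant.
   Context: $\mathfrak g=\mathfrak{so}(4)=\mathfrak g_1\oplus\mathfrak g_2$ with each $\mathfrak g_i\cong\mathfrak{so}(3)$ carrying the bi-invariant metric $\langle Z_1,Z_2\rangle=\tfrac12\operatorname{trace}(Z_1Z_2^T)$; $h_0$ is the product bi-invariant metric. The matrix of $h$ is the $h_0$-self-adjoint positive definite $\Phi$ with $h(X,Y)=h_0(\Phi X,Y)$. *)

theory Defs
  imports "HOL-Analysis.Analysis"
begin

text \<open>The Lie algebra so(4) = g1 (+) g2 with each gi = so(3), realised as pairs of
  skew-symmetric real 3x3 matrices, with the matrix commutator as Lie bracket.\<close>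

type_synonym m3 = "real^3^3"
type_synonym lie = "m3 \<times> m3"

definition so3 :: "m3 set" where
  "so3 = {A. transpose A = - A}"

definition gso4 :: "lie set" where
  "gso4 = so3 \<times> so3"

definition lbr :: "lie \<Rightarrow> lie \<Rightarrow> lie" where
  "lbr X Y = (fst X ** fst Y - fst Y ** fst X, snd X ** snd Y - snd Y ** snd X)"

text \<open>Bi-invariant metric on so(3): <Z1,Z2> = 1/2 trace(Z1 Z2^T); h0 is the product metric.\<close>

definition ip3 :: "m3 \<Rightarrow> m3 \<Rightarrow> real" where
  "ip3 A B = trace (A ** transpose B) / 2"

definition h0 :: "lie \<Rightarrow> lie \<Rightarrow> real" where
  "h0 X Y = ip3 (fst X) (fst Y) + ip3 (snd X) (snd Y)"

text \<open>A left-invariant metric h on SO(4) = inner product on its Lie algebra, encoded by its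
  matrix Phi: h(X,Y) = h0(Phi X, Y), Phi h0-self-adjoint and positive definite.\<close>

definition hmet :: "(lie \<Rightarrow> lie) \<Rightarrow> lie \<Rightarrow> lie \<Rightarrow> real" where
  "hmet \<Phi> X Y = h0 (\<Phi> X) Y"

definition metric_matrix :: "(lie \<Rightarrow> lie) \<Rightarrow> bool" where
  "metric_matrix \<Phi> \<longleftrightarrow> linear \<Phi> \<and> \<Phi> ` gso4 \<subseteq> gso4
     \<and> (\<forall>X\<in>gso4. \<forall>Y\<in>gso4. h0 (\<Phi> X) Y = h0 X (\<Phi> Y))
     \<and> (\<forall>X\<in>gso4. X \<noteq> 0 \<longrightarrow> h0 (\<Phi> X) X > 0)"

text \<open>Levi-Civita connection on left-invariant vector fields (Koszul formula):
  2 h(nabla_X Y, W) = h([X,Y],W) - h([Y,W],X) + h([W,X],Y).\<close>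

definition lc_conn :: "(lie \<Rightarrow> lie) \<Rightarrow> lie \<Rightarrow> lie \<Rightarrow> lie" where
  "lc_conn \<Phi> X Y = (THE Z. Z \<in> gso4 \<and> (\<forall>W\<in>gso4.
      2 * hmet \<Phi> Z W = hmet \<Phi> (lbr X Y) W - hmet \<Phi> (lbr Y W) X + hmet \<Phi> (lbr W X) Y))"

definition curv :: "(lie \<Rightarrow> lie) \<Rightarrow> lie \<Rightarrow> lie \<Rightarrow> lie \<Rightarrow> lie" where
  "curv \<Phi> X Y Z = lc_conn \<Phi> X (lc_conn \<Phi> Y Z) - lc_conn \<Phi> Y (lc_conn \<Phi> X Z)
                    - lc_conn \<Phi> (lbr X Y) Z"

definition nonneg_sec_curv :: "(lie \<Rightarrow> lie) \<Rightarrow> bool" where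
  "nonneg_sec_curv \<Phi> \<longleftrightarrow> (\<forall>X\<in>gso4. \<forall>Y\<in>gso4. hmet \<Phi> (curv \<Phi> X Y Y) X \<ge> 0)"

end

theory Submission
  imports Defs
begin

text \<open>
  Identify $\mathfrak{so}(4)$ with $V = \mathbb{R}^3 \times \mathbb{R}^3$ with componentwise cross
  product. Let $S = \Phi^{-1}$, let $\lambda$ be its largest eigenvalue, and let
  $\Psi = \lambda - S \ge 0$ have blocks $P, Q, Q^T, R$. The curvature of the plane spanned by
  $S(a,0)$ and $S(0,b)$ gives, after the term containing $\Phi$ is bounded by a quadratic one in
  $S$, an inequality $C(a,b) \ge 0$ from which $\lambda$ has disappeared. If $(a,b) \in \ker\Psi$,
  then $C(a,b) = -\langle \Psi D, D\rangle$ with $D = (Pa \times a, b \times Rb)$, so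
  $D \in \ker\Psi$. When $P$ and $R$ are nonsingular, the first projection of $\ker\Psi$ is
  therefore a subspace of $\mathbb{R}^3$ closed under $a \mapsto Pa \times a$; it contains an
  eigenvector $a$ of $P$, and the corresponding $b$ is an eigenvector of $R$, so that $(a,0)$ and
  $(0,b)$ span an invariant plane. When $P$ or $R$ is singular, $Q$ has rank at most one and the
  plane is found directly.
\<close>

section \<open>Symmetric operators and their eigenvectors\<close>

unbundle cross3_syntax

lemma parallel_of_cross3_eq_0:
  assumes "x \<times> y = 0" "x \<noteq> 0"
  shows "\<exists>c. y = c *\<^sub>R x"
  using assms by (auto simp: cross_eq_0 collinear_lemma)

text \<open>A zero of a nonnegative quadratic form is a minimum: moving from \<open>x\<close>
  against a nonzero \<open>f x\<close> would make the form negative.\<close>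

lemma psd_kernel:
  fixes f :: "'a::real_inner \<Rightarrow> 'a"
  assumes f: "linear f" and sym: "\<And>x y. f x \<bullet> y = x \<bullet> f y"
    and psd: "\<And>x. 0 \<le> f x \<bullet> x" and x: "f x \<bullet> x = 0"
  shows "f x = 0"
proof (rule ccontr)
  assume nz: "f x \<noteq> 0"
  define y where "y = f x"
  \<comment> \<open>The minimiser of \<open>- 2 * t * (y \<bullet> y) + t\<^sup>2 * (1 + f y
    \<bullet> y)\<close>; the summand 1 keeps the denominator positive even if
    \<open>f y \<bullet> y = 0\<close>.\<close>
  define t where "t = (y \<bullet> y) / (1 + f y \<bullet> y)"
  have yy: "y \<bullet> y > 0" using nz by (simp add: y_def)
  have d: "1 + f y \<bullet> y > 0" using psd[of y] by linarith
  have tp: "t > 0" using yy d by (simp add: t_def)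
  have "f (x - t *\<^sub>R y) \<bullet> (x - t *\<^sub>R y) = - 2 * t * (y \<bullet> y) + t\<^sup>2 * (f y \<bullet> y)"
    using x sym[of x "f x"]
    by (simp add: linear_diff[OF f] linear_scale[OF f] inner_diff_left inner_diff_right y_def
        inner_commute power2_eq_square algebra_simps)
  also have "\<dots> < - 2 * t * (y \<bullet> y) + t * (t * (1 + f y \<bullet> y))"
    using tp by (simp add: power2_eq_square algebra_simps)
  also have "\<dots> = - t * (y \<bullet> y)" using d by (simp add: t_def)
  also have "\<dots> < 0" using tp yy by simp
  finally show False using psd[of "x - t *\<^sub>R y"] by linarith
qed

text \<open>The Rayleigh quotient attains its maximum \<open>c\<close> on the compact unit sphere.
  The form of c minus \<open>f\<close> is nonnegative and vanishes at the maximiser, so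
  \<open>psd_kernel\<close> applies.\<close>

lemma max_eigenvector:
  fixes f :: "'a::euclidean_space \<Rightarrow> 'a"
  assumes f: "linear f" and sym: "\<And>x y. f x \<bullet> y = x \<bullet> f y"
  obtains x c where "x \<noteq> 0" "f x = c *\<^sub>R x" "\<And>y. f y \<bullet> y \<le> c * (y \<bullet> y)"
proof -
  let ?S = "sphere (0::'a) 1"
  have "continuous_on ?S (\<lambda>x. f x \<bullet> x)"
    using linear_continuous_on[OF linear_conv_bounded_linear[THEN iffD1, OF f]]
    by (intro continuous_intros)
  moreover have "?S \<noteq> {}" by simp
  ultimately obtain x where x: "x \<in> ?S" and mx: "\<And>y. y \<in> ?S \<Longrightarrow> f y \<bullet> y \<le> f x \<bullet> x"
    using continuous_attains_sup[of ?S "\<lambda>x. f x \<bullet> x"] by auto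
  define c where "c = f x \<bullet> x"
  have xx: "x \<bullet> x = 1" using x by (simp add: dot_square_norm)
  have le: "f y \<bullet> y \<le> c * (y \<bullet> y)" for y
  proof (cases "y = 0")
    case True then show ?thesis by simp
  next
    case False
    have "f ((1 / norm y) *\<^sub>R y) \<bullet> ((1 / norm y) *\<^sub>R y) \<le> c"
      using mx[of "(1 / norm y) *\<^sub>R y"] False by (simp add: c_def)
    then have "f y \<bullet> y / (norm y)\<^sup>2 \<le> c"
      by (simp add: linear_scale[OF f] power2_eq_square)
    then show ?thesis using False by (simp add: dot_square_norm field_simps)
  qed
  let ?g = "\<lambda>y. c *\<^sub>R y - f y"
  have "?g x = 0"
  proof (rule psd_kernel[where f="?g"])
    show "linear ?g" using f by (intro linear_compose_sub linear_compose_scale_right linear_id[unfolded id_def])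
    show "?g x \<bullet> y = x \<bullet> ?g y" for x y by (simp add: inner_diff_left inner_diff_right sym)
    show "0 \<le> ?g y \<bullet> y" for y using le[of y] by (simp add: inner_diff_left)
    show "?g x \<bullet> x = 0" using xx by (simp add: inner_diff_left c_def)
  qed
  moreover have "x \<noteq> 0" using xx by auto
  ultimately show thesis using that[of x c] le by simp
qed

text \<open>Unless \<open>a\<close> itself works, \<open>U\<close> contains the orthogonal vectors
  \<open>a\<close> and \<open>P a \<times> a\<close>, so it is a plane or the whole space.\<close>

lemma eigenvector_in_cross_closed_subspace:
  fixes P :: "real^3 \<Rightarrow> real^3"
  assumes P: "linear P" and sym: "\<And>x y. P x \<bullet> y = x \<bullet> P y"
    and U: "subspace U" and nz: "a \<in> U" "a \<noteq> 0"
    and closed: "\<And>a. a \<in> U \<Longrightarrow> P a \<times> a \<in> U"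
  shows "\<exists>a\<in>U. a \<noteq> 0 \<and> P a \<times> a = 0"
proof (cases "P a \<times> a = 0")
  case True then show ?thesis using nz by blast
next
  case False
  define w where "w = P a \<times> a"
  define n where "n = a \<times> w"
  \<comment> \<open>\<open>U\<close> is either the plane orthogonal to \<open>n\<close>, on which \<open>P\<close> compresses to a scalar, or everything.\<close>
  have w0: "w \<noteq> 0" using False w_def by simp
  have aw: "a \<bullet> w = 0" by (simp add: w_def dot_cross_self)
  have wU: "w \<in> U" using closed nz w_def by simp
  have n0: "n \<noteq> 0" unfolding n_def using aw nz(2) w0 norm_and_cross_eq_0 by metis
  have na: "n \<bullet> a = 0" "n \<bullet> w = 0" "a \<bullet> n = 0" "w \<bullet> n = 0" by (simp_all add: n_def dot_cross_self)
  have expand: "y = ((y \<bullet> a) / (a \<bullet> a)) *\<^sub>R a + ((y \<bullet> w) / (w \<bullet> w)) *\<^sub>R w + ((y \<bullet> n) / (n \<bullet> n)) *\<^sub>R n" for y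
  proof -
    define d where "d = y - ((y \<bullet> a) / (a \<bullet> a)) *\<^sub>R a - ((y \<bullet> w) / (w \<bullet> w)) *\<^sub>R w - ((y \<bullet> n) / (n \<bullet> n)) *\<^sub>R n"
    have da: "d \<bullet> a = 0" "d \<bullet> w = 0" "d \<bullet> n = 0"
      using nz w0 n0 aw na by (simp_all add: d_def inner_diff_left inner_commute[of w a])
    \<comment> \<open>The double product \<open>(a \<times> w) \<times> d\<close> involves only
      \<open>d \<bullet> a\<close> and \<open>d \<bullet> w\<close>; so \<open>d\<close> is parallel
      to \<open>n\<close> as well as orthogonal to it.\<close>
    have "n \<times> d = 0" using da by (simp add: n_def cross_skew[of "a \<times> w"] Lagrange inner_commute)
    then have "d = 0" using da n0 norm_and_cross_eq_0[of n d] by (simp add: inner_commute)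
    then show ?thesis by (simp add: d_def algebra_simps)
  qed
  have perp: "y \<in> U" if "y \<bullet> n = 0" for y
    by (subst expand) (use that nz wU U in \<open>auto intro!: subspace_add subspace_scale\<close>)
  show ?thesis
  proof (cases "\<exists>y\<in>U. y \<bullet> n \<noteq> 0")
    case True
    then obtain y where y: "y \<in> U" "y \<bullet> n \<noteq> 0" by blast
    have "y - ((y \<bullet> n) / (n \<bullet> n)) *\<^sub>R n \<in> U"
      using n0 by (intro perp) (simp add: inner_diff_left)
    then have "y - (y - ((y \<bullet> n) / (n \<bullet> n)) *\<^sub>R n) \<in> U" using y(1) U subspace_diff by blast
    then have "((y \<bullet> n) / (n \<bullet> n)) *\<^sub>R n \<in> U" by simp
    from subspace_scale[OF U this, of "(n \<bullet> n) / (y \<bullet> n)"]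
    have nU: "n \<in> U" using y(2) n0 by simp
    have "y \<in> U" for y
      by (subst expand) (use nz wU nU U in \<open>intro subspace_add subspace_scale\<close>)
    then have "U = UNIV" by blast
    moreover obtain x c where "x \<noteq> 0" "P x = c *\<^sub>R x" using max_eigenvector[OF P sym] by metis
    ultimately have "x \<in> U" "x \<noteq> 0" "P x \<times> x = 0" by (simp_all add: cross_mult_left)
    then show ?thesis by blast
  next
    case False
    \<comment> \<open>Now \<open>U\<close> is the plane orthogonal to \<open>n\<close>. Choosing
      \<open>x\<close> so that \<open>x\<close> and \<open>P x\<close> both lie in it makes
      \<open>P x \<times> x\<close> parallel to \<open>n\<close>, while closure of \<open>U\<close>
      makes it orthogonal to \<open>n\<close>.\<close>
    obtain x where x: "x \<noteq> 0" "x \<bullet> n = 0" "x \<bullet> P n = 0"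
    proof (cases "n \<times> P n = 0")
      case True
      then obtain c where "P n = c *\<^sub>R n" using parallel_of_cross3_eq_0 n0 by blast
      then show thesis using that[of a] nz na by (simp add: inner_commute)
    next
      case False
      then show thesis using that[of "n \<times> P n"] by (simp add: dot_cross_self)
    qed
    have xU: "x \<in> U" using perp x by simp
    have "n \<bullet> (P x \<times> x) = 0" using False closed[OF xU] by (auto simp: inner_commute)
    moreover have "n \<times> (P x \<times> x) = 0"
      using x sym[of x n] by (simp add: Lagrange inner_commute)
    ultimately have "P x \<times> x = 0" using n0 norm_and_cross_eq_0[of n "P x \<times> x"] by (simp add: inner_commute)
    then show ?thesis using xU x by blast
  qed
qed

section \<open>Linear algebra of the block inequality\<close>

text \<open>All that the search for the plane needs from the metric: the blocks of \<Psi>, its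
  semidefiniteness, and, as \<open>curv\<close>, the inequality C(a,b) \<ge> 0.\<close>

locale curvature_blocks =
  fixes P Q Qt R :: "real^3 \<Rightarrow> real^3"
  assumes lin: "linear P" "linear Q" "linear Qt" "linear R"
    and symP: "P a \<bullet> a' = a \<bullet> P a'" and symR: "R b \<bullet> b' = b \<bullet> R b'"
    and adj: "a \<bullet> Q b = Qt a \<bullet> b"
    and psd: "0 \<le> P a \<bullet> a + 2 * (a \<bullet> Q b) + R b \<bullet> b"
    and curv: "0 \<le> (a \<times> Q b) \<bullet> (P a \<times> Q b) + (Qt a \<times> b) \<bullet> (Qt a \<times> R b)
      - P (a \<times> Q b) \<bullet> (a \<times> Q b) - R (Qt a \<times> b) \<bullet> (Qt a \<times> b)
      - (a \<times> Q b) \<bullet> Q (Qt a \<times> b) + (P a \<times> a) \<bullet> Q (R b \<times> b)"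
begin

text \<open>With \<open>a\<close> and \<open>b\<close> nonzero, the vanishing products say that each
  block maps the line of \<open>a\<close> or \<open>b\<close> into one of these two lines, so that
  \<open>(a, 0)\<close> and \<open>(0, b)\<close> span a \<Psi>-invariant plane.\<close>

definition invariant_pair :: "real^3 \<Rightarrow> real^3 \<Rightarrow> bool" where
  "invariant_pair a b \<longleftrightarrow> a \<noteq> 0 \<and> b \<noteq> 0 \<and> a \<times> P a = 0 \<and> a \<times> Q b = 0 \<and> b \<times> Qt a = 0 \<and> b \<times> R b = 0"

lemmas lin_simps =
  linear_0[OF lin(1)] linear_0[OF lin(2)] linear_0[OF lin(3)] linear_0[OF lin(4)]
  linear_neg[OF lin(1)] linear_neg[OF lin(2)] linear_neg[OF lin(3)] linear_neg[OF lin(4)]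
  linear_add[OF lin(1)] linear_add[OF lin(2)] linear_add[OF lin(3)] linear_add[OF lin(4)]
  linear_diff[OF lin(1)] linear_diff[OF lin(2)] linear_diff[OF lin(3)] linear_diff[OF lin(4)]
  linear_scale[OF lin(1)] linear_scale[OF lin(2)] linear_scale[OF lin(3)] linear_scale[OF lin(4)]

text \<open>Exchanging the two factors reverses every mixed product such as
  \<open>a \<times> Q b\<close>; these occur in pairs, and adjointness restores the two terms with
  \<open>Q\<close>.\<close>

lemma swap: "curvature_blocks R Qt Q P"
proof (rule curvature_blocks.intro)
  fix b a
  have u: "Q b \<times> a = - (a \<times> Q b)" and v: "b \<times> Qt a = - (Qt a \<times> b)"
    "R b \<times> Qt a = - (Qt a \<times> R b)" "Q b \<times> P a = - (P a \<times> Q b)"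
    by (rule cross_skew)+
  have "(b \<times> Qt a) \<bullet> Qt (Q b \<times> a) = (a \<times> Q b) \<bullet> Q (Qt a \<times> b)"
    using adj[of "a \<times> Q b" "Qt a \<times> b"] inner_commute[of "Qt a \<times> b" "Qt (a \<times> Q b)"]
    by (simp add: u v lin_simps)
  moreover have "(R b \<times> b) \<bullet> Qt (P a \<times> a) = (P a \<times> a) \<bullet> Q (R b \<times> b)"
    by (metis adj inner_commute)
  ultimately show "0 \<le> (b \<times> Qt a) \<bullet> (R b \<times> Qt a) + (Q b \<times> a) \<bullet> (Q b \<times> P a)
      - R (b \<times> Qt a) \<bullet> (b \<times> Qt a) - P (Q b \<times> a) \<bullet> (Q b \<times> a)
      - (b \<times> Qt a) \<bullet> Qt (Q b \<times> a) + (R b \<times> b) \<bullet> Qt (P a \<times> a)"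
    using curv[of a b] by (simp add: u v lin_simps)
next
  show "0 \<le> R a \<bullet> a + 2 * (a \<bullet> Qt b) + P b \<bullet> b" for a b
    using psd[of b a] by (simp add: adj inner_commute)
qed (use lin symP symR adj in \<open>auto simp: inner_commute\<close>)

definition \<Psi> :: "(real^3) \<times> (real^3) \<Rightarrow> (real^3) \<times> (real^3)" where
  "\<Psi> x = (P (fst x) + Q (snd x), Qt (fst x) + R (snd x))"

lemma \<Psi>_inner: "\<Psi> (a, b) \<bullet> (a, b) = P a \<bullet> a + 2 * (a \<bullet> Q b) + R b \<bullet> b"
  using adj[of a b] inner_commute[of "Q b" a]
  by (simp add: \<Psi>_def inner_add_left)

lemma linear_\<Psi>: "linear \<Psi>"
  by (rule linearI) (auto simp: \<Psi>_def lin_simps algebra_simps)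

lemma \<Psi>_kernel:
  assumes "\<Psi> x \<bullet> x \<le> 0"
  shows "\<Psi> x = 0"
proof (rule psd_kernel[OF linear_\<Psi>])
  have "Q b \<bullet> a = b \<bullet> Qt a" for a b by (metis adj inner_commute)
  then show "\<Psi> x \<bullet> y = x \<bullet> \<Psi> y" for x y
    by (simp add: \<Psi>_def inner_prod_def inner_add_left inner_add_right symP symR adj)
  show psd': "0 \<le> \<Psi> y \<bullet> y" for y
    using psd \<Psi>_inner[of "fst y" "snd y"] by simp
  show "\<Psi> x \<bullet> x = 0" using assms psd'[of x] by simp
qed

text \<open>On the kernel \<open>Q b = - P a\<close> and \<open>Qt a = - R b\<close>. This kills the
  first two terms of \<open>curv\<close>, and what remains is minus the form of \<Psi> at the new
  vector.\<close>

lemma kernel_step: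
  assumes "\<Psi> (a, b) = 0"
  shows "\<Psi> (P a \<times> a, b \<times> R b) = 0"
proof (rule \<Psi>_kernel)
  have e: "Q b = - P a" "Qt a = - R b"
    using assms by (simp_all add: \<Psi>_def zero_prod_def add_eq_0_iff add_eq_0_iff2)
  have s: "a \<times> P a = - (P a \<times> a)" "R b \<times> b = - (b \<times> R b)" by (rule cross_skew)+
  show "\<Psi> (P a \<times> a, b \<times> R b) \<bullet> (P a \<times> a, b \<times> R b) \<le> 0"
    using curv[of a b] unfolding \<Psi>_inner by (simp add: e s lin_simps cross_minus_left cross_minus_right)
qed

text \<open>Semidefiniteness puts the kernel of \<open>P\<close> into that of \<open>Qt\<close>, and
  \<open>curv\<close> then adds \<open>a \<times> Q b\<close> to the kernel of \<open>P\<close>. So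
  either \<open>Q\<close> is zero, or its range is a single line, which \<open>P\<close> maps into
  itself.\<close>

lemma pair_if_P_singular:
  assumes a: "P a = 0" "a \<noteq> 0"
  shows "\<exists>a b. invariant_pair a b"
proof -
  have ker: "Qt x = 0" if "P x = 0" for x
    using \<Psi>_kernel[of "(x, 0)"] that by (simp add: \<Psi>_def zero_prod_def lin_simps inner_prod_def)
  \<comment> \<open>Since \<open>P a\<close> and \<open>Qt a\<close> vanish,
    \<open>- P (a \<times> Q b) \<bullet> (a \<times> Q b)\<close> is the only term of
    \<open>curv\<close> left.\<close>
  have Pw: "P (a \<times> Q b) = 0" for b
  proof -
    have "P (a \<times> Q b) \<bullet> (a \<times> Q b) \<le> 0"
      using curv[of a b] a ker[of a] by (simp add: lin_simps)
    then have "\<Psi> (a \<times> Q b, 0) = 0"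
      by (intro \<Psi>_kernel) (simp add: \<Psi>_inner lin_simps)
    then show ?thesis by (simp add: \<Psi>_def zero_prod_def lin_simps)
  qed
  show ?thesis
  proof (cases "\<forall>b. Q b = 0")
    case True
    obtain b c where "b \<noteq> 0" "R b = c *\<^sub>R b"
      using max_eigenvector[OF lin(4) symR] by metis
    then have "invariant_pair a b"
      using a True ker[of a] by (simp add: invariant_pair_def cross_mult_right)
    then show ?thesis by blast
  next
    case False
    then obtain b0 where b0: "Q b0 \<noteq> 0" by blast
    define e where "e = Q b0"
    define w where "w = a \<times> e"
    have ae: "a \<bullet> e = 0" using ker[OF a(1)] by (simp add: e_def adj)
    have e0: "e \<noteq> 0" using b0 e_def by simp
    have w0: "w \<noteq> 0" unfolding w_def
      using ae a(2) e0 norm_and_cross_eq_0 by blast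
    have Pw0: "P w = 0" using Pw by (simp add: w_def e_def)
    \<comment> \<open>The vectors \<open>a\<close>, \<open>e\<close>, \<open>w\<close> form an
      orthogonal basis.\<close>
    have par: "e \<times> y = 0" if "y \<bullet> a = 0" "y \<bullet> w = 0" for y
    proof -
      have "a \<times> (e \<times> y) = 0"
        using that ae by (simp add: Lagrange inner_commute)
      moreover have "a \<bullet> (e \<times> y) = 0"
        using that(2) cross_triple[of a e y] by (simp add: w_def inner_commute)
      ultimately show ?thesis using a(2) norm_and_cross_eq_0[of a "e \<times> y"] by (simp add: inner_commute)
    qed
    have Qpar: "e \<times> Q b = 0" for b
      by (rule par) (use adj[of a b] adj[of w b] ker[OF a(1)] ker[OF Pw0] in \<open>simp_all add: inner_commute\<close>)
    have Ppar: "e \<times> P e = 0"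
      by (rule par) (use symP a Pw0 in \<open>simp_all\<close>)
    define q where "q = Qt e"
    have "q \<bullet> b0 = e \<bullet> e" by (metis adj q_def e_def)
    then have q0: "q \<noteq> 0" using e0 by auto
    \<comment> \<open>Putting \<open>e\<close> and \<open>s *\<^sub>R q + R q\<close> into
      \<open>curv\<close> leaves an inequality affine in \<open>s\<close> with slope
      \<open>z \<bullet> z\<close>. It cannot hold for all real \<open>s\<close> unless this slope
      is zero.\<close>
    have "q \<times> R q = 0"
    proof (rule ccontr)
      assume nz: "q \<times> R q \<noteq> 0"
      define z where "z = q \<times> R q"
      define k where "k = z \<bullet> (q \<times> R (R q)) - R z \<bullet> z"
      have zz: "z \<bullet> z > 0" using nz by (simp add: z_def)
      have "0 \<le> s * (z \<bullet> z) + k" for s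
      proof -
        have Pe: "P e \<times> e = 0" using Ppar by (subst cross_skew) simp
        have v: "q \<times> (s *\<^sub>R q + R q) = z" by (simp add: z_def cross_add_right cross_mult_right)
        show ?thesis
          using curv[of e "s *\<^sub>R q + R q"]
          unfolding q_def[symmetric] v Qpar Pe
          by (simp add: lin_simps k_def cross_add_right cross_mult_right z_def[symmetric] inner_add_right)
      qed
      from this[of "- (k + 1) / (z \<bullet> z)"] show False using zz by simp
    qed
    then have "invariant_pair e q"
      using e0 q0 Ppar Qpar by (simp add: invariant_pair_def q_def)
    then show ?thesis by blast
  qed
qed

lemma pair_if_R_singular:
  assumes "R b = 0" "b \<noteq> 0"
  shows "\<exists>a b. invariant_pair a b"
proof -
  interpret s: curvature_blocks R Qt Q P by (rule swap)
  show ?thesis using s.pair_if_P_singular[OF assms]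
    unfolding invariant_pair_def s.invariant_pair_def by blast
qed

lemma pair_if_singular:
  assumes "\<Psi> (a, b) = 0" "(a, b) \<noteq> 0"
  shows "\<exists>a b. invariant_pair a b"
proof (cases "(\<exists>a. a \<noteq> 0 \<and> P a = 0) \<or> (\<exists>b. b \<noteq> 0 \<and> R b = 0)")
  case True
  then show ?thesis using pair_if_P_singular pair_if_R_singular by blast
next
  case False
  define U where "U = fst ` {x. \<Psi> x = 0}"
  \<comment> \<open>Injectivity of \<open>P\<close> and \<open>R\<close> makes the kernel of \<Psi>
    the graph of an injective linear map on \<open>U\<close>.\<close>
  have zero: "(x = 0) = (y = 0)" if "\<Psi> (x, y) = 0" for x y
  proof -
    have e: "P x + Q y = 0" "Qt x + R y = 0" using that by (simp_all add: \<Psi>_def zero_prod_def)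
    show ?thesis
    proof
      assume "x = 0"
      then have "R y = 0" using e by (simp add: lin_simps)
      then show "y = 0" using False by blast
    next
      assume "y = 0"
      then have "P x = 0" using e by (simp add: lin_simps)
      then show "x = 0" using False by blast
    qed
  qed
  have "subspace {x. \<Psi> x = 0}" using linear_\<Psi> by (rule linear_subspace_kernel)
  then have "subspace U" unfolding U_def by (rule linear_subspace_image[OF linear_fst])
  moreover have "a \<in> U" using assms by (force simp: U_def)
  moreover have "a \<noteq> 0" using assms zero[of a b] by (metis zero_prod_def)
  moreover have "P x \<times> x \<in> U" if "x \<in> U" for x
    using that kernel_step unfolding U_def by force
  ultimately obtain x where x: "x \<in> U" "x \<noteq> 0" "P x \<times> x = 0"
    using eigenvector_in_cross_closed_subspace[OF lin(1) symP] by meson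
  then obtain y where y: "\<Psi> (x, y) = 0" by (auto simp: U_def)
  then have y0: "y \<noteq> 0" using zero x by blast
  \<comment> \<open>By \<open>kernel_step\<close>, \<open>(0, y \<times> R y)\<close> lies in the
    kernel, and the graph property forces its second entry to vanish.\<close>
  have yR: "y \<times> R y = 0" using kernel_step[OF y] x(3) zero[of 0 "y \<times> R y"] by simp
  have xP: "x \<times> P x = 0" using x(3) by (subst cross_skew) simp
  have "Q y = - P x" "Qt x = - R y"
    using y by (simp_all add: \<Psi>_def zero_prod_def add_eq_0_iff add_eq_0_iff2)
  then have "invariant_pair x y"
    using x y0 yR xP by (simp add: invariant_pair_def cross_minus_right)
  then show ?thesis by blast
qed

end

section \<open>Curvature of a left-invariant metric in cross product coordinates\<close>

type_synonym v6 = "(real^3) \<times> (real^3)"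

definition br :: "v6 \<Rightarrow> v6 \<Rightarrow> v6" where
  "br x y = (fst x \<times> fst y, snd x \<times> snd y)"

lemma br_skew: "br x y = - br y x"
  using cross_skew[of "fst x" "fst y"] cross_skew[of "snd x" "snd y"] by (simp add: br_def)

lemma br_self [simp]: "br x x = 0"
  by (simp add: br_def zero_prod_def)

text \<open>Bi-invariance of the product metric, from the cyclic symmetry of the scalar triple
  product.\<close>

lemma br_inner: "br x y \<bullet> z = x \<bullet> br y z"
  using cross_triple[of "fst x" "fst y" "fst z"] cross_triple[of "snd x" "snd y" "snd z"]
  by (simp add: br_def inner_prod_def inner_commute)

text \<open>\<open>T\<close> stands for \<Phi> in vector coordinates, and \<open>S\<close> for its
  inverse.\<close>

locale metric_operator =
  fixes T S :: "v6 \<Rightarrow> v6"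
  assumes linT: "linear T" and linS: "linear S"
    and TS [simp]: "T (S x) = x" and ST [simp]: "S (T x) = x"
    and symT: "T x \<bullet> y = x \<bullet> T y"
    and posT: "x \<noteq> 0 \<Longrightarrow> 0 < T x \<bullet> x"
begin

lemma symS: "S x \<bullet> y = x \<bullet> S y"
  using symT[of "S x" "S y"] by simp

lemmas lin_simps =
  linear_0[OF linT] linear_0[OF linS] linear_neg[OF linT] linear_neg[OF linS]
  linear_add[OF linT] linear_add[OF linS] linear_diff[OF linT] linear_diff[OF linS]
  linear_scale[OF linT] linear_scale[OF linS]

text \<open>Applying \<open>S\<close> gives the symmetric part of the Levi-Civita connection. It
  measures the deviation from bi-invariance and is zero when \<open>T\<close> is the
  identity.\<close>

definition sym_br :: "v6 \<Rightarrow> v6 \<Rightarrow> v6" where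
  "sym_br x y = (1/2) *\<^sub>R (br x (T y) + br y (T x))"

definition conn :: "v6 \<Rightarrow> v6 \<Rightarrow> v6" where
  "conn x y = (1/2) *\<^sub>R br x y + S (sym_br x y)"

lemma koszul:
  "2 * (T (conn x y) \<bullet> w) = T (br x y) \<bullet> w - T (br y w) \<bullet> x + T (br w x) \<bullet> y"
proof -
  have "T (br y w) \<bullet> x = - (br y (T x) \<bullet> w)"
    by (metis br_inner br_skew inner_commute inner_minus_right symT)
  moreover have "T (br w x) \<bullet> y = br x (T y) \<bullet> w"
    by (metis br_inner inner_commute symT)
  ultimately show ?thesis
    by (simp add: conn_def sym_br_def lin_simps inner_add_left)
qed

text \<open>Compatibility with the metric: inner products of left-invariant fields are constant, so
  the connection acts by skew operators.\<close>

lemma conn_metric: "T (conn x y) \<bullet> w = - (T y \<bullet> conn x w)"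
proof -
  have "T (br w y) = - T (br y w)" "T (br y x) = - T (br x y)" "T (br w x) = - T (br x w)"
    using br_skew linear_neg[OF linT] by metis+
  then have "2 * (T (conn x y) \<bullet> w) = - (2 * (T (conn x w) \<bullet> y))"
    using koszul[of x y w] koszul[of x w y] by simp
  then show ?thesis by (simp add: symT inner_commute)
qed

definition riem :: "v6 \<Rightarrow> v6 \<Rightarrow> v6 \<Rightarrow> v6" where
  "riem x y z = conn x (conn y z) - conn y (conn x z) - conn (br x y) z"

text \<open>Puettmann's formula for the unnormalised sectional curvature. In the two iterated terms
  the outer connection is moved across by \<open>conn_metric\<close>; the bracket term is given by
  \<open>koszul\<close>.\<close>

lemma riem_formula:
  "T (riem x y y) \<bullet> x = sym_br x y \<bullet> S (sym_br x y) - sym_br x x \<bullet> S (sym_br y y)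
     - 3/4 * (T (br x y) \<bullet> br x y) + 1/2 * (br x y \<bullet> (br (T x) y + br x (T y)))"
proof -
  let ?z = "br x y"
  let ?B = "sym_br x y"
  have Bs: "sym_br y x = ?B" by (simp add: sym_br_def add.commute)
  have c: "conn u u = S (sym_br u u)" for u by (simp add: conn_def)
  have t1: "T (conn x (conn y y)) \<bullet> x = - (sym_br x x \<bullet> S (sym_br y y))"
    using conn_metric[of x "conn y y" x] symS[of "sym_br x x" "sym_br y y"]
    by (simp add: c inner_commute)
  have yx: "conn y x = - (1/2) *\<^sub>R ?z + S ?B"
    using br_skew[of y x] by (simp add: conn_def Bs)
  have "T (conn y (conn x y)) \<bullet> x = - (T (conn x y) \<bullet> conn y x)" by (rule conn_metric)
  also have "T (conn x y) \<bullet> conn y x = ?B \<bullet> S ?B - 1/4 * (T ?z \<bullet> ?z)"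
    unfolding yx using symT[of ?z "S ?B"]
    by (simp add: conn_def lin_simps inner_add_left inner_add_right inner_diff_right inner_commute)
  finally have t2: "T (conn y (conn x y)) \<bullet> x = - (?B \<bullet> S ?B) + 1/4 * (T ?z \<bullet> ?z)" by simp
  have k: "2 * (T (conn ?z y) \<bullet> x) = T (br ?z y) \<bullet> x - T (br y x) \<bullet> ?z + T (br x ?z) \<bullet> y"
    by (rule koszul)
  have a1: "T (br ?z y) \<bullet> x = - (?z \<bullet> br (T x) y)"
    using br_skew[of y "T x"] br_inner[of ?z y "T x"] by (simp add: symT)
  have a2: "T (br y x) \<bullet> ?z = - (T ?z \<bullet> ?z)"
    using br_skew[of y x] by (simp add: lin_simps)
  have a3: "T (br x ?z) \<bullet> y = - (?z \<bullet> br x (T y))"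
    using br_skew[of x ?z] br_inner[of ?z x "T y"] by (simp add: symT)
  show ?thesis
    unfolding riem_def lin_simps inner_diff_left t1 t2 using k unfolding a1 a2 a3
    by (simp add: inner_add_right field_simps)
qed

text \<open>The supporting hyperplane at $Sw$ of the convex quadratic form of $T$; it replaces $T$ by its inverse.\<close>

lemma T_lower_bound: "2 * (x \<bullet> w) - S w \<bullet> w \<le> T x \<bullet> x"
proof -
  have "0 \<le> T (x - S w) \<bullet> (x - S w)"
    using posT[of "x - S w"] by (cases "x - S w = 0") (auto simp: less_imp_le)
  then show ?thesis
    using symT[of x "S w"]
    by (simp add: lin_simps inner_diff_left inner_diff_right inner_commute)
qed

text \<open>At the arguments \<open>S X\<close> and \<open>S Y\<close> the operator \<open>T\<close>
  cancels everywhere except in the term with weight 3/4, which \<open>T_lower_bound\<close>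
  estimates.\<close>

lemma riem_bound:
  fixes X Y :: v6
  defines "E \<equiv> (1/2) *\<^sub>R (br (S X) Y + br (S Y) X)" and "F \<equiv> br X (S Y) + br (S X) Y"
  assumes nonneg: "\<And>x y. 0 \<le> T (riem x y y) \<bullet> x"
  shows "0 \<le> E \<bullet> S E - br (S X) X \<bullet> S (br (S Y) Y) - br (S X) (S Y) \<bullet> F + 3/4 * (S F \<bullet> F)"
proof -
  have "0 \<le> E \<bullet> S E - br (S X) X \<bullet> S (br (S Y) Y) - 3/4 * (T (br (S X) (S Y)) \<bullet> br (S X) (S Y))
     + 1/2 * (br (S X) (S Y) \<bullet> F)"
    using nonneg[of "S X" "S Y"] unfolding riem_formula
    by (simp add: E_def F_def sym_br_def flip: scaleR_add_right mult_2 scaleR_2)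
  \<comment> \<open>With \<open>w\<close> taken as \<open>F\<close>, the product of the bracket with
    \<open>F\<close> gets the total factor 1/2 - 3/2 = -1.\<close>
  then show ?thesis using T_lower_bound[of "br (S X) (S Y)" F] by simp
qed

text \<open>The terms with the factor $l$ cancel, whatever $l$ is.\<close>

lemma blocks:
  fixes l :: real
  assumes nonneg: "\<And>x y. 0 \<le> T (riem x y y) \<bullet> x"
    and top: "\<And>x. S x \<bullet> x \<le> l * (x \<bullet> x)"
  shows "curvature_blocks (\<lambda>a. l *\<^sub>R a - fst (S (a, 0))) (\<lambda>b. - fst (S (0, b)))
           (\<lambda>a. - snd (S (a, 0))) (\<lambda>b. l *\<^sub>R b - snd (S (0, b)))"
proof -
  define P where "P = (\<lambda>a. l *\<^sub>R a - fst (S (a, 0)))"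
  define Q where "Q = (\<lambda>b. - fst (S (0, b)))"
  define Qt where "Qt = (\<lambda>a. - snd (S (a, 0)))"
  define R where "R = (\<lambda>b. l *\<^sub>R b - snd (S (0, b)))"
  have add1: "S (a + a', 0) = S (a, 0) + S (a', 0)" and add2: "S (0, b + b') = S (0, b) + S (0, b')"
    and sc1: "S (c *\<^sub>R a, 0) = c *\<^sub>R S (a, 0)" and sc2: "S (0, c *\<^sub>R b) = c *\<^sub>R S (0, b)"
    for a a' b b' c
    by (simp_all flip: lin_simps)
  have lin: "linear P" "linear Q" "linear Qt" "linear R"
    by (rule linearI; simp add: P_def Q_def Qt_def R_def add1 add2 sc1 sc2 algebra_simps)+
  have S_eq: "S (a, b) = (l *\<^sub>R a - P a - Q b, l *\<^sub>R b - Qt a - R b)" for a b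
    using linear_add[OF linS, of "(a, 0)" "(0, b)"]
    by (simp add: P_def Q_def Qt_def R_def prod_eq_iff)
  note lin0 = linear_0[OF lin(1)] linear_0[OF lin(2)] linear_0[OF lin(3)] linear_0[OF lin(4)]
    linear_neg[OF lin(1)] linear_neg[OF lin(2)] linear_neg[OF lin(3)] linear_neg[OF lin(4)]
  have symP: "P a \<bullet> a' = a \<bullet> P a'" for a a'
    using symS[of "(a, 0)" "(a', 0)"] by (simp add: S_eq lin0 inner_diff_left inner_diff_right)
  have symR: "R b \<bullet> b' = b \<bullet> R b'" for b b'
    using symS[of "(0, b)" "(0, b')"] by (simp add: S_eq lin0 inner_diff_left inner_diff_right)
  have adj: "a \<bullet> Q b = Qt a \<bullet> b" for a b
    using symS[of "(a, 0)" "(0, b)"] by (simp add: S_eq lin0)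
  have quad: "S (a, b) \<bullet> (a, b)
      = l * (a \<bullet> a) + l * (b \<bullet> b) - P a \<bullet> a - 2 * (a \<bullet> Q b) - R b \<bullet> b" for a b
    using adj[of a b] inner_commute[of "Q b" a] by (simp add: S_eq inner_diff_left)
  have "curvature_blocks P Q Qt R"
  proof (rule curvature_blocks.intro)
    show "0 \<le> P a \<bullet> a + 2 * (a \<bullet> Q b) + R b \<bullet> b" for a b
      using top[of "(a, b)"] by (simp add: quad distrib_left)
    fix a b
    let ?u = "a \<times> Q b" and ?v = "Qt a \<times> b"
    have sk: "Q b \<times> a = - ?u" by (rule cross_skew)
    \<comment> \<open>Up to an overall sign, \<open>E\<close> and \<open>F\<close> differ only in
      the sign of \<open>?v\<close>. With weights 1/4 and 3/4 the diagonal terms add up to weight 1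
      and the \<open>Q\<close> terms to 2 * (1/4 - 3/4) = -1; the multiples of \<open>l\<close>
      cancel against those in \<open>h\<close>.\<close>
    have E: "br (S (a, 0)) (0, b) + br (S (0, b)) (a, 0) = (?u, - ?v)"
      and F: "br (a, 0) (S (0, b)) + br (S (a, 0)) (0, b) = - (?u, ?v)"
      and z: "br (S (a, 0)) (S (0, b)) = (P a \<times> Q b - l *\<^sub>R ?u, Qt a \<times> R b - l *\<^sub>R ?v)"
      and X: "br (S (a, 0)) (a, 0) = - (P a \<times> a, 0)"
      and Y: "br (S (0, b)) (0, b) = - (0, R b \<times> b)"
      by (simp_all add: S_eq lin0 br_def sk Cross3.left_diff_distrib Cross3.right_diff_distrib
          cross_mult_left cross_mult_right)
    have e: "((1/2) *\<^sub>R w) \<bullet> S ((1/2) *\<^sub>R w) = 1/4 * (S w \<bullet> w)" for w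
      unfolding lin_simps by (simp add: inner_commute)
    have f: "S (- w) \<bullet> (- w) = S w \<bullet> w" for w
      unfolding lin_simps by simp
    have g: "- (P a \<times> a, 0) \<bullet> S (- (0, R b \<times> b)) = - ((P a \<times> a) \<bullet> Q (R b \<times> b))"
      unfolding lin_simps by (simp add: S_eq lin0)
    have h: "(P a \<times> Q b - l *\<^sub>R ?u, Qt a \<times> R b - l *\<^sub>R ?v) \<bullet> (- (?u, ?v))
      = l * (?u \<bullet> ?u) + l * (?v \<bullet> ?v) - ?u \<bullet> (P a \<times> Q b) - ?v \<bullet> (Qt a \<times> R b)"
      by (simp add: inner_diff_left inner_commute[of ?u "P a \<times> Q b"]
          inner_commute[of ?v "Qt a \<times> R b"])
    show "0 \<le> ?u \<bullet> (P a \<times> Q b) + ?v \<bullet> (Qt a \<times> R b) - P ?u \<bullet> ?u - R ?v \<bullet> ?v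
      - ?u \<bullet> Q ?v + (P a \<times> a) \<bullet> Q (R b \<times> b)"
      using riem_bound[OF nonneg, of "(a, 0)" "(0, b)"]
      unfolding E F X Y z e f g h quad by (simp add: lin0 algebra_simps)
  qed (use lin symP symR adj in auto)
  then show ?thesis by (simp add: P_def Q_def Qt_def R_def)
qed

end

section \<open>Transfer between so(4) and pairs of vectors\<close>

text \<open>The standard isomorphism onto so(3): \<open>hat a\<close> is the matrix of the cross
  product with \<open>a\<close> on the left.\<close>

definition hat :: "real^3 \<Rightarrow> m3" where
  "hat a = vector [vector [0, - a$3, a$2], vector [a$3, 0, - a$1], vector [- a$2, a$1, 0]]"

definition unhat :: "m3 \<Rightarrow> real^3" where
  "unhat A = vector [A$3$2, A$1$3, A$2$1]"

lemma hat_in_so3: "hat a \<in> so3"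
  by (simp add: so3_def hat_def transpose_def vec_eq_iff forall_3)

lemma unhat_hat [simp]: "unhat (hat a) = a"
  by (simp add: hat_def unhat_def vec_eq_iff forall_3)

lemma hat_unhat:
  assumes "A \<in> so3"
  shows "hat (unhat A) = A"
proof -
  have e: "A $ j $ i = - A $ i $ j" for i j
  proof -
    have "transpose A $ i $ j = (- A) $ i $ j" using assms by (simp add: so3_def)
    then show ?thesis by (simp add: transpose_def)
  qed
  show ?thesis
    using e[of 1 1] e[of 2 2] e[of 3 3] e[of 2 1] e[of 1 3] e[of 3 2]
    by (simp add: hat_def unhat_def vec_eq_iff forall_3)
qed

lemma linear_hat: "linear hat"
  by (rule linearI) (simp_all add: hat_def vec_eq_iff forall_3)

lemma linear_unhat: "linear unhat"
  by (rule linearI) (simp_all add: unhat_def vec_eq_iff forall_3)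

lemma hat_cross: "hat (a \<times> b) = hat a ** hat b - hat b ** hat a"
  by (simp add: hat_def vec_eq_iff forall_3 matrix_matrix_mult_def sum_3 cross_components algebra_simps)

text \<open>Each coordinate occurs twice in the matrix, so the factor 1/2 in \<open>ip3\<close>
  makes \<open>hat\<close> an isometry.\<close>

lemma ip3_hat: "ip3 (hat a) (hat b) = a \<bullet> b"
  by (simp add: ip3_def hat_def trace_def matrix_matrix_mult_def transpose_def sum_3 inner_vec_def)

definition hats :: "v6 \<Rightarrow> lie" where
  "hats x = (hat (fst x), hat (snd x))"

definition unhats :: "lie \<Rightarrow> v6" where
  "unhats X = (unhat (fst X), unhat (snd X))"

lemma hats_in_gso4: "hats x \<in> gso4"
  by (simp add: hats_def gso4_def hat_in_so3)

lemma unhats_hats [simp]: "unhats (hats x) = x"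
  by (simp add: hats_def unhats_def)

lemma hats_unhats: "X \<in> gso4 \<Longrightarrow> hats (unhats X) = X"
  by (auto simp: hats_def unhats_def gso4_def hat_unhat)

lemma hats_eq_iff [simp]: "hats x = hats y \<longleftrightarrow> x = y"
  by (metis unhats_hats)

lemma gso4_cases:
  assumes "X \<in> gso4" obtains x where "X = hats x"
  using hats_unhats[OF assms] by metis

lemma linear_hats: "linear hats"
  by (rule linearI) (simp_all add: hats_def linear_add[OF linear_hat] linear_scale[OF linear_hat])

lemma linear_unhats: "linear unhats"
  by (rule linearI) (simp_all add: unhats_def linear_add[OF linear_unhat] linear_scale[OF linear_unhat])

lemma lbr_hats: "lbr (hats x) (hats y) = hats (br x y)"
  by (simp add: lbr_def hats_def br_def hat_cross)

lemma h0_hats: "h0 (hats x) (hats y) = x \<bullet> y"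
  by (simp add: h0_def hats_def ip3_hat inner_prod_def)

lemma dim_span_orthogonal_pair:
  fixes x y :: "'a::euclidean_space"
  assumes "x \<noteq> 0" "y \<noteq> 0" "x \<bullet> y = 0"
  shows "dim (span {x, y}) = 2"
proof -
  have ne: "x \<noteq> y" using assms by auto
  have "independent {x, y}"
    using assms by (intro pairwise_orthogonal_independent)
      (auto simp: pairwise_def orthogonal_def inner_commute)
  then show ?thesis using ne by (simp add: dim_eq_card_independent)
qed

section \<open>The invariant abelian plane in so(4)\<close>

locale so4_metric =
  fixes \<Phi> :: "lie \<Rightarrow> lie"
  assumes metric: "metric_matrix \<Phi>"
begin

definition T :: "v6 \<Rightarrow> v6" where "T x = unhats (\<Phi> (hats x))"

lemma \<Phi>_hats: "\<Phi> (hats x) = hats (T x)"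
proof -
  have "\<Phi> (hats x) \<in> gso4"
    using metric hats_in_gso4[of x] by (auto simp: metric_matrix_def)
  then show ?thesis by (simp add: T_def hats_unhats)
qed

lemma linear_T: "linear T"
proof -
  have "linear \<Phi>" using metric by (simp add: metric_matrix_def)
  then have "linear (unhats \<circ> (\<Phi> \<circ> hats))"
    by (intro linear_compose linear_hats linear_unhats)
  then show ?thesis by (simp add: T_def[abs_def] comp_def)
qed

lemma T_sym: "T x \<bullet> y = x \<bullet> T y"
proof -
  have "h0 (\<Phi> (hats x)) (hats y) = h0 (hats x) (\<Phi> (hats y))"
    using metric hats_in_gso4 by (simp add: metric_matrix_def)
  then show ?thesis by (simp add: \<Phi>_hats h0_hats)
qed

lemma T_pos:
  assumes "x \<noteq> 0"
  shows "0 < T x \<bullet> x"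
proof -
  have "hats x \<noteq> 0" using assms hats_eq_iff[of x 0] linear_0[OF linear_hats] by simp
  then have "0 < h0 (\<Phi> (hats x)) (hats x)"
    using metric hats_in_gso4 unfolding metric_matrix_def by blast
  then show ?thesis by (simp add: \<Phi>_hats h0_hats)
qed

lemma inverse_exists: "\<exists>S. metric_operator T S"
proof -
  have "inj T"
    unfolding linear_injective_0[OF linear_T] using T_pos by (metis inner_zero_left less_irrefl)
  then obtain S where S: "linear S" "\<forall>x. S (T x) = x" "\<forall>x. T (S x) = x"
    using linear_injective_isomorphism[OF linear_T] by blast
  then have "metric_operator T S"
    using linear_T T_sym T_pos by (intro metric_operator.intro) auto
  then show ?thesis by blast
qed

lemma hmet_hats: "hmet \<Phi> (hats x) (hats y) = T x \<bullet> y"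
  by (simp add: hmet_def \<Phi>_hats h0_hats)

text \<open>The definite description is met: \<open>koszul\<close> gives existence, and
  nondegeneracy of the inner product with injectivity of \<open>T\<close> gives uniqueness.\<close>

lemma lc_conn_hats:
  assumes "metric_operator T S"
  shows "lc_conn \<Phi> (hats x) (hats y) = hats (metric_operator.conn T S x y)"
proof -
  interpret m: metric_operator T S by fact
  show ?thesis unfolding lc_conn_def
  proof (rule the_equality)
    have "2 * hmet \<Phi> (hats (m.conn x y)) W =
      hmet \<Phi> (lbr (hats x) (hats y)) W - hmet \<Phi> (lbr (hats y) W) (hats x)
        + hmet \<Phi> (lbr W (hats x)) (hats y)" if "W \<in> gso4" for W
    proof -
      obtain w where "W = hats w" using gso4_cases \<open>W \<in> gso4\<close> by blast
      then show ?thesis using m.koszul[of x y w] by (simp add: lbr_hats hmet_hats)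
    qed
    then show "hats (m.conn x y) \<in> gso4 \<and> (\<forall>W\<in>gso4. 2 * hmet \<Phi> (hats (m.conn x y)) W =
      hmet \<Phi> (lbr (hats x) (hats y)) W - hmet \<Phi> (lbr (hats y) W) (hats x)
        + hmet \<Phi> (lbr W (hats x)) (hats y))"
      using hats_in_gso4 by blast
    fix Z
    assume Z: "Z \<in> gso4 \<and> (\<forall>W\<in>gso4. 2 * hmet \<Phi> Z W =
      hmet \<Phi> (lbr (hats x) (hats y)) W - hmet \<Phi> (lbr (hats y) W) (hats x)
        + hmet \<Phi> (lbr W (hats x)) (hats y))"
    then obtain z where z: "Z = hats z" using gso4_cases by blast
    have "2 * (T z \<bullet> w) = 2 * (T (m.conn x y) \<bullet> w)" for w
    proof -
      have "2 * hmet \<Phi> Z (hats w) =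
        hmet \<Phi> (lbr (hats x) (hats y)) (hats w) - hmet \<Phi> (lbr (hats y) (hats w)) (hats x)
          + hmet \<Phi> (lbr (hats w) (hats x)) (hats y)"
        using Z hats_in_gso4[of w] by blast
      then show ?thesis by (simp add: z lbr_hats hmet_hats m.koszul)
    qed
    then have "T z = T (m.conn x y)" by (intro vector_eq_rdot[THEN iffD1]) simp
    then show "Z = hats (m.conn x y)" unfolding z by (metis m.ST)
  qed
qed

lemma curv_hats:
  assumes "metric_operator T S"
  shows "curv \<Phi> (hats x) (hats y) (hats z) = hats (metric_operator.riem T S x y z)"
  by (simp add: curv_def lc_conn_hats[OF assms] lbr_hats metric_operator.riem_def[OF assms]
      linear_diff[OF linear_hats])

lemma invariant_abelian_plane:
  assumes "nonneg_sec_curv \<Phi>"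
  shows "\<exists>V. subspace V \<and> V \<subseteq> gso4 \<and> dim V = 2
           \<and> (\<forall>X\<in>V. \<forall>Y\<in>V. lbr X Y = 0) \<and> \<Phi> ` V \<subseteq> V"
proof -
  obtain S where S: "metric_operator T S" using inverse_exists by blast
  interpret m: metric_operator T S by fact
  have nonneg: "0 \<le> T (m.riem x y y) \<bullet> x" for x y
    using assms hats_in_gso4[of x] hats_in_gso4[of y] unfolding nonneg_sec_curv_def
    by (metis S curv_hats hmet_hats)
  obtain x l where x: "x \<noteq> 0" "S x = l *\<^sub>R x" and top: "\<And>y. S y \<bullet> y \<le> l * (y \<bullet> y)"
    using max_eigenvector[OF m.linS m.symS] by metis
  interpret b: curvature_blocks "\<lambda>a. l *\<^sub>R a - fst (S (a, 0))" "\<lambda>b. - fst (S (0, b))"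
      "\<lambda>a. - snd (S (a, 0))" "\<lambda>b. l *\<^sub>R b - snd (S (0, b))"
    by (rule m.blocks[OF nonneg top])
  \<comment> \<open>\<Psi> is \<open>l\<close> minus \<open>S\<close>, and \<open>x\<close> is an
    eigenvector of \<open>S\<close> for \<open>l\<close>.\<close>
  have "b.\<Psi> x = 0"
    using x(2) linear_add[OF m.linS, of "(fst x, 0)" "(0, snd x)"]
    by (cases x) (simp add: b.\<Psi>_def prod_eq_iff algebra_simps)
  then obtain a b where ab: "b.invariant_pair a b"
    using b.pair_if_singular[of "fst x" "snd x"] x(1) by auto
  then have nz: "a \<noteq> 0" "b \<noteq> 0"
    and par0: "a \<times> (l *\<^sub>R a - fst (S (a, 0))) = 0" "a \<times> - fst (S (0, b)) = 0"
      "b \<times> - snd (S (a, 0)) = 0" "b \<times> (l *\<^sub>R b - snd (S (0, b))) = 0"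
    unfolding b.invariant_pair_def by auto
  have par: "a \<times> fst (S (a, 0)) = 0" "a \<times> fst (S (0, b)) = 0"
      "b \<times> snd (S (a, 0)) = 0" "b \<times> snd (S (0, b)) = 0"
    using par0 by (simp_all add: Cross3.right_diff_distrib cross_mult_right)
  \<comment> \<open>One line from each factor: cross products of parallel vectors vanish, so the
    image of \<open>W\<close> in so(4) is abelian.\<close>
  define W where "W = span {(a, 0), (0::real^3, b)}"
  have W_mem: "(s *\<^sub>R a, t *\<^sub>R b) \<in> W" for s t
  proof -
    have "s *\<^sub>R (a, 0) + t *\<^sub>R (0, b) \<in> W"
      unfolding W_def by (intro span_add span_scale span_base) auto
    then show ?thesis by simp
  qed
  have W_cases: "\<exists>s t. y = (s *\<^sub>R a, t *\<^sub>R b)" if "y \<in> W" for y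
    using that unfolding W_def span_insert by (auto simp: prod_eq_iff span_singleton algebra_simps)
  have subW: "subspace W" by (simp add: W_def)
  have dimW: "dim W = 2"
    unfolding W_def using nz by (intro dim_span_orthogonal_pair) (auto simp: zero_prod_def)
  have "S (a, 0) \<in> W" "S (0, b) \<in> W"
    using parallel_of_cross3_eq_0[OF par(1) nz(1)] parallel_of_cross3_eq_0[OF par(2) nz(1)]
      parallel_of_cross3_eq_0[OF par(3) nz(2)] parallel_of_cross3_eq_0[OF par(4) nz(2)] W_mem
    by (metis prod.collapse)+
  then have "S ` W \<subseteq> W"
    unfolding W_def linear_span_image[OF m.linS, symmetric] by (intro span_minimal) auto
  moreover have "dim (S ` W) = dim W"
    using m.linS by (intro dim_image_eq) (auto intro!: inj_on_inverseI[of _ T])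
  \<comment> \<open>\<open>S\<close> is injective and maps \<open>W\<close> into itself, hence onto
    itself by dimension; so its inverse \<open>T\<close> preserves \<open>W\<close> too.\<close>
  ultimately have SW: "S ` W = W"
    using subW linear_subspace_image[OF m.linS subW] by (intro subspace_dim_equal) auto
  have TW: "T y \<in> W" if "y \<in> W" for y
    using that SW by (metis imageE m.TS)
  show ?thesis
  proof (intro exI[of _ "hats ` W"] conjI ballI)
    show "subspace (hats ` W)" by (rule linear_subspace_image[OF linear_hats subW])
    show "hats ` W \<subseteq> gso4" using hats_in_gso4 by blast
    show "dim (hats ` W) = 2"
      using dimW dim_image_eq[OF linear_hats, of W] by (simp add: inj_on_def)
    show "\<Phi> ` hats ` W \<subseteq> hats ` W" using TW by (auto simp: \<Phi>_hats)
    fix X Y assume "X \<in> hats ` W" "Y \<in> hats ` W"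
    then obtain s t s' t' where "X = hats (s *\<^sub>R a, t *\<^sub>R b)" "Y = hats (s' *\<^sub>R a, t' *\<^sub>R b)"
      using W_cases by blast
    then show "lbr X Y = 0"
      using linear_0[OF linear_hats]
      by (simp add: lbr_hats br_def cross_mult_left cross_mult_right zero_prod_def)
  qed
qed

end

theorem mainTheorem11:
  fixes \<Phi> :: "lie \<Rightarrow> lie"
  assumes "metric_matrix \<Phi>"
    and "nonneg_sec_curv \<Phi>"
  shows "\<exists>V. subspace V \<and> V \<subseteq> gso4 \<and> dim V = 2
           \<and> (\<forall>X\<in>V. \<forall>Y\<in>V. lbr X Y = 0) \<and> \<Phi> ` V \<subseteq> V"
  using so4_metric.invariant_abelian_plane[OF so4_metric.intro[OF assms(1)] assms(2)] .

end
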